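(* Let $D$ be a digraph on $n$ vertices that has at least one out-branching. If $D$ has minimum in-degree at least $3$, or if $D$ is an oriented graph with minimum in-degree at least $2$, then $\ell(D)\geq \frac{1}{4}\sqrt{n}$.
   Context: An out-tree of a digraph $D$ is a subgraph of $D$ that is a tree (ignoring arc directions) in which exactly one vertex, the root, has in-degree $0$ and every other vertex has in-degree $1$. An out-branching is a spanning out-tree. A leaf is a vertex of out-degree $0$ in the out-tree. $\ell(D)$ denotes the maximum number of leaves over all out-trees of $D$. A digraph is an oriented graph if $(u,v)\in A(D)$ implies $(v,u)\notin A(D)$. *)

theory Defs
  imports Complex_Main
begin

text \<open>A (finite, loopless) digraph is given by a finite vertex set V and an arc
relation A \<subseteq> V \<times> V without loops (no parallel arcs, as A is a set).\<close>

definition digraph :: "'a set \<Rightarrow> ('a \<times> 'a) set \<Rightarrow> bool" where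
  "digraph V A \<longleftrightarrow> finite V \<and> A \<subseteq> V \<times> V \<and> (\<forall>v. (v, v) \<notin> A)"

definition in_degree :: "('a \<times> 'a) set \<Rightarrow> 'a \<Rightarrow> nat" where
  "in_degree A v = card {u. (u, v) \<in> A}"

definition out_degree :: "('a \<times> 'a) set \<Rightarrow> 'a \<Rightarrow> nat" where
  "out_degree A v = card {w. (v, w) \<in> A}"

definition oriented :: "('a \<times> 'a) set \<Rightarrow> bool" where
  "oriented A \<longleftrightarrow> (\<forall>u v. (u, v) \<in> A \<longrightarrow> (v, u) \<notin> A)"

text \<open>Underlying undirected graph is connected on TV.\<close>
definition und_connected :: "'a set \<Rightarrow> ('a \<times> 'a) set \<Rightarrow> bool" where
  "und_connected TV TA \<longleftrightarrow> (\<forall>u\<in>TV. \<forall>v\<in>TV. (u, v) \<in> (TA \<union> TA\<inverse>)\<^sup>*)"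

text \<open>Underlying graph is a tree: connected and with |TV| - 1 edges
  (arcs in both directions between two vertices count as two edges).\<close>
definition und_tree :: "'a set \<Rightarrow> ('a \<times> 'a) set \<Rightarrow> bool" where
  "und_tree TV TA \<longleftrightarrow> finite TV \<and> TV \<noteq> {} \<and> TA \<subseteq> TV \<times> TV \<and>
     und_connected TV TA \<and> card TA = card TV - 1"

text \<open>(TV, TA) is an out-tree of the digraph (V, A).\<close>
definition out_tree :: "'a set \<Rightarrow> ('a \<times> 'a) set \<Rightarrow> 'a set \<Rightarrow> ('a \<times> 'a) set \<Rightarrow> bool" where
  "out_tree V A TV TA \<longleftrightarrow> TV \<subseteq> V \<and> TA \<subseteq> A \<and> und_tree TV TA \<and>
     (\<exists>r\<in>TV. in_degree TA r = 0 \<and> (\<forall>v\<in>TV - {r}. in_degree TA v = 1))"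

definition out_branching :: "'a set \<Rightarrow> ('a \<times> 'a) set \<Rightarrow> ('a \<times> 'a) set \<Rightarrow> bool" where
  "out_branching V A TA \<longleftrightarrow> out_tree V A V TA"

definition leaves :: "'a set \<Rightarrow> ('a \<times> 'a) set \<Rightarrow> 'a set" where
  "leaves TV TA = {v \<in> TV. out_degree TA v = 0}"

text \<open>\<ell>(D): maximum number of leaves over all out-trees of D.\<close>
definition max_leaves :: "'a set \<Rightarrow> ('a \<times> 'a) set \<Rightarrow> nat" where
  "max_leaves V A = Max {card (leaves TV TA) | TV TA. out_tree V A TV TA}"

end

theory Submission
  imports Defs
begin

text \<open>
  Let \<open>k = \<ell>(D)\<close> and take an out-branching \<open>B\<close> with the most leaves. It has at most \<open>2k - 1\<close>
  vertices of out-degree different from 1, so it splits into at most \<open>2k - 1\<close> paths whose vertices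
  other than the last have a unique child. It suffices that each path has at most \<open>8k + 3\<close>
  vertices, since \<open>(2k - 1)(8k + 3) \<le> 16k\<^sup>2\<close>.

  By the in-degree condition, every inner vertex \<open>v\<close> of such a path has an in-neighbour \<open>u\<close> that
  is neither its parent nor its child. If \<open>u\<close> is not a descendant of \<open>v\<close>, then \<open>u\<close> is a leaf of
  \<open>B\<close>: otherwise making \<open>u\<close> the parent of \<open>v\<close> gains a leaf. Call \<open>v\<close> bad in this case and good
  otherwise, and let \<open>b\<close> be the lowest bad vertex. The part of the path below \<open>b\<close> hangs off the
  subtree below the path, and the part above \<open>b\<close> hangs off the rest of the out-branching in which
  \<open>b\<close> is reattached to its leaf. In both situations each path vertex has an in-arc from the
  base out-tree or from a path vertex at least two places further down.

  Let such a path have \<open>m\<close> vertices. Using these back arcs only, every vertex outside the set \<open>W\<close>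
  of their tails on the path becomes a leaf. Alternatively, a vertex with successor \<open>y \<in> W\<close> on the
  upward path may be made a child of \<open>y\<close>, which then can serve as parent both of this vertex and of
  the head of its back arc, so that one further leaf arises; a third of \<open>W\<close> can be treated
  this way simultaneously. Hence there are at least \<open>max (m - |W|) (|W|/3) \<ge> m/4\<close> leaves,
  and \<open>m \<le> 4k\<close>.
\<close>

section \<open>Out-trees as rooted reachability structures\<close>

definition arborescence :: "'a \<Rightarrow> 'a set \<Rightarrow> ('a \<times> 'a) set \<Rightarrow> bool" where
  "arborescence r V T \<longleftrightarrow> finite V \<and> r \<in> V \<and> T \<subseteq> V \<times> V \<and> (\<forall>u. (u, r) \<notin> T) \<and>
     (\<forall>u u' v. (u, v) \<in> T \<longrightarrow> (u', v) \<in> T \<longrightarrow> u = u') \<and> (\<forall>v\<in>V. (r, v) \<in> T\<^sup>*)"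

lemma arborescenceD:
  assumes "arborescence r V T"
  shows "finite V" "r \<in> V" "T \<subseteq> V \<times> V" "(u, r) \<notin> T"
    "(u, v) \<in> T \<Longrightarrow> (u', v) \<in> T \<Longrightarrow> u = u'" "v \<in> V \<Longrightarrow> (r, v) \<in> T\<^sup>*" "finite T"
  using assms unfolding arborescence_def
  by (blast, blast, blast, blast, blast, blast, meson finite_SigmaI finite_subset)

lemma arborescence_parent:
  assumes T: "arborescence r V T" and v: "v \<in> V" "v \<noteq> r"
  obtains u where "(u, v) \<in> T"
  using arborescenceD(6)[OF T v(1)] v(2) by (auto elim: rtranclE)

text \<open>Since parents are unique, a cycle through a vertex also passes through its parent. Going
  up along the path from \<open>r\<close>, the cycle would reach \<open>r\<close>, which has no
  in-arc.\<close>

lemma arborescence_acyclic: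
  assumes T: "arborescence r V T"
  shows "(v, v) \<notin> T\<^sup>+"
proof
  assume v: "(v, v) \<in> T\<^sup>+"
  then have "v \<in> V" using arborescenceD(3)[OF T] by (meson mem_Sigma_iff subsetD tranclD)
  then have "(r, v) \<in> T\<^sup>*" using arborescenceD(6)[OF T] by blast
  then show False using v
  proof (induction rule: rtrancl_induct)
    case base
    then show ?case using arborescenceD(4)[OF T] by (meson tranclD2)
  next
    case (step y z)
    from step.prems obtain u where "(z, u) \<in> T\<^sup>*" "(u, z) \<in> T" by (meson tranclD2)
    then have "(z, y) \<in> T\<^sup>*" using step.hyps(2) arborescenceD(5)[OF T] by blast
    then have "(y, y) \<in> T\<^sup>+" using step.hyps(2) by (meson rtrancl_into_trancl2)
    then show ?case using step.IH by blast
  qed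
qed

lemma arborescence_card:
  assumes T: "arborescence r V T"
  shows "card T = card V - 1"
proof -
  have "inj_on snd T"
    using arborescenceD(5)[OF T] by (auto simp: inj_on_def)
  moreover have "snd ` T = V - {r}"
  proof
    show "snd ` T \<subseteq> V - {r}" using arborescenceD(3,4)[OF T] by force
    show "V - {r} \<subseteq> snd ` T"
    proof
      fix v assume "v \<in> V - {r}"
      then obtain u where "(u, v) \<in> T" using arborescence_parent[OF T] by blast
      then show "v \<in> snd ` T" by force
    qed
  qed
  ultimately have "card T = card (V - {r})" by (metis card_image)
  then show ?thesis using arborescenceD(1,2)[OF T] by simp
qed

lemma in_degree_1_unique:
  assumes "in_degree T v = 1" "(u, v) \<in> T" "(u', v) \<in> T"
  shows "u = u'"
  using assms unfolding in_degree_def by (metis card_1_singletonE mem_Collect_eq singletonD)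

text \<open>All later constructions use the right-hand side: after changing parents, only
  reachability from the root has to be checked, instead of undirected connectivity and an arc
  count.\<close>

lemma out_tree_iff_arborescence:
  assumes "finite V"
  shows "out_tree V A U T \<longleftrightarrow> U \<subseteq> V \<and> T \<subseteq> A \<and> (\<exists>r. arborescence r U T)"
proof
  assume ot: "out_tree V A U T"
  then obtain r where r: "r \<in> U" "in_degree T r = 0" "\<forall>v\<in>U - {r}. in_degree T v = 1"
    and sub: "U \<subseteq> V" "T \<subseteq> A" and tree: "und_tree U T"
    unfolding out_tree_def by blast
  have fin: "finite U" "T \<subseteq> U \<times> U" and conn: "und_connected U T"
    using tree unfolding und_tree_def by auto
  have finT: "finite T" using fin by (meson finite_SigmaI finite_subset)
  have "finite {u. (u, v) \<in> T}" for v
    by (rule finite_subset[of _ "fst ` T"]) (use finT in force)+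
  then have no_in: "(u, r) \<notin> T" for u
    using r(2) unfolding in_degree_def by (auto simp: card_eq_0_iff)
  have uniq: "u = u'" if "(u, v) \<in> T" "(u', v) \<in> T" for u u' v
  proof -
    have "v \<in> U - {r}" using that fin(2) no_in by auto
    then show ?thesis using r(3) in_degree_1_unique that by metis
  qed
  have "(r, v) \<in> T\<^sup>*" if "v \<in> U" for v
  proof -
    have "(r, v) \<in> (T \<union> T\<inverse>)\<^sup>*" using conn r(1) that unfolding und_connected_def by blast
    then show ?thesis
    proof (induction rule: rtrancl_induct)
      case (step y z)
      show ?case
      proof (cases "(y, z) \<in> T")
        case False
        \<comment> \<open>An arc of the undirected walk that is traversed backwards must be the
          unique in-arc of \<open>y\<close>, so \<open>z\<close> already lies on the directed path
          from \<open>r\<close> to \<open>y\<close>.\<close>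
        then have "(z, y) \<in> T" using step.hyps by auto
        moreover from this have "y \<noteq> r" using no_in by blast
        then obtain u where "(r, u) \<in> T\<^sup>*" "(u, y) \<in> T" using step.IH by (metis rtranclE)
        ultimately show ?thesis using uniq by blast
      qed (use step.IH in auto)
    qed simp
  qed
  then have "arborescence r U T"
    unfolding arborescence_def using fin r(1) no_in uniq by blast
  then show "U \<subseteq> V \<and> T \<subseteq> A \<and> (\<exists>r. arborescence r U T)" using sub by blast
next
  assume "U \<subseteq> V \<and> T \<subseteq> A \<and> (\<exists>r. arborescence r U T)"
  then obtain r where sub: "U \<subseteq> V" "T \<subseteq> A" and T: "arborescence r U T" by blast
  have conn: "und_connected U T"
    unfolding und_connected_def
  proof (intro ballI)
    fix u v assume uv: "u \<in> U" "v \<in> U"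
    then have "(r, u) \<in> T\<^sup>*" "(r, v) \<in> T\<^sup>*" using arborescenceD(6)[OF T] by auto
    then have "(u, r) \<in> (T \<union> T\<inverse>)\<^sup>*" "(r, v) \<in> (T \<union> T\<inverse>)\<^sup>*"
      by (metis in_rtrancl_UnI rtrancl_converseI, meson in_rtrancl_UnI)
    then show "(u, v) \<in> (T \<union> T\<inverse>)\<^sup>*" by (rule rtrancl_trans)
  qed
  have "in_degree T r = 0" unfolding in_degree_def using arborescenceD(4)[OF T] by simp
  moreover have "in_degree T v = 1" if v: "v \<in> U - {r}" for v
  proof -
    obtain u where "(u, v) \<in> T" using arborescence_parent[OF T, of v] v by blast
    then have "{u. (u, v) \<in> T} = {u}" using arborescenceD(5)[OF T, of _ v u] by blast
    then show ?thesis unfolding in_degree_def by simp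
  qed
  ultimately show "out_tree V A U T"
    unfolding out_tree_def und_tree_def
    using sub conn arborescenceD(1-3)[OF T] arborescence_card[OF T] by blast
qed

lemma card_leaves_le_max_leaves:
  assumes "digraph V A" "out_tree V A U T"
  shows "card (leaves U T) \<le> max_leaves V A"
proof -
  have "{card (leaves U T) | U T. out_tree V A U T} \<subseteq> {..card V}"
    using assms(1) unfolding digraph_def out_tree_def leaves_def
    by (auto intro!: card_mono)
  then have "finite {card (leaves U T) | U T. out_tree V A U T}"
    by (rule finite_subset) simp
  then show ?thesis unfolding max_leaves_def using assms(2) by (intro Max_ge) auto
qed

lemma leaves_iff:
  assumes "finite T"
  shows "v \<in> leaves U T \<longleftrightarrow> v \<in> U \<and> (\<forall>w. (v, w) \<notin> T)"
proof -
  have "finite {w. (v, w) \<in> T}"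
    by (rule finite_subset[of _ "snd ` T"]) (use assms in force)+
  then show ?thesis unfolding leaves_def out_degree_def by auto
qed

section \<open>Attaching a path to an out-tree\<close>

text \<open>\<open>p\<close> chooses the parents of the new vertices. The last assumption says that
  each chain of new parents ends in \<open>U\<close>, which rules out cycles inside
  \<open>X\<close>.\<close>

lemma arborescence_extend:
  fixes x p
  assumes T: "arborescence r U T" and "finite X" "X \<inter> U = {}"
    and p: "\<And>v. v \<in> X \<Longrightarrow> p v \<in> U \<union> X"
    and reach: "\<And>v. v \<in> X \<Longrightarrow> \<exists>u\<in>U. (u, v) \<in> {(p v, v) |v. v \<in> X}\<^sup>*"
  shows "arborescence r (U \<union> X) (T \<union> {(p v, v) |v. v \<in> X})"
proof -
  let ?P = "{(p v, v) |v. v \<in> X}"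
  have "(r, v) \<in> (T \<union> ?P)\<^sup>*" if v: "v \<in> U \<union> X" for v
  proof (cases "v \<in> U")
    case True
    then show ?thesis using arborescenceD(6)[OF T] by (meson in_rtrancl_UnI)
  next
    case False
    then obtain u where "u \<in> U" "(u, v) \<in> ?P\<^sup>*" using v reach by blast
    then show ?thesis using arborescenceD(6)[OF T]
      by (meson in_rtrancl_UnI rtrancl_trans)
  qed
  then show ?thesis
    unfolding arborescence_def
    using assms(2,3) p arborescenceD(1-5)[OF T] by (auto; blast)
qed

text \<open>Greedy choice: keep the minimum \<open>a\<close>, discard \<open>f a\<close> and
  \<open>g a\<close>, and continue. Each round uses up at most three elements, and as
  \<open>a\<close> is the least one, only pairs with smaller member \<open>a\<close> need
  checking.\<close>

lemma greedy_independent_set: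
  fixes S :: "nat set"
  assumes "finite S"
  shows "\<exists>R\<subseteq>S. card S \<le> 3 * card R \<and> (\<forall>x\<in>R. \<forall>y\<in>R. x < y \<longrightarrow> y \<noteq> f x \<and> y \<noteq> g x)"
  using assms
proof (induction "card S" arbitrary: S rule: less_induct)
  case less
  show ?case
  proof (cases "S = {}")
    case False
    define a where "a = Min S"
    define S' where "S' = S - {a, f a, g a}"
    have a: "a \<in> S" "\<forall>x\<in>S. a \<le> x" using less.prems False unfolding a_def by auto
    have "card S' < card S"
      unfolding S'_def by (rule psubset_card_mono) (use less.prems a in auto)
    then obtain R where R: "R \<subseteq> S'" "card S' \<le> 3 * card R"
      "\<forall>x\<in>R. \<forall>y\<in>R. x < y \<longrightarrow> y \<noteq> f x \<and> y \<noteq> g x"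
      using less.hyps[of S'] less.prems unfolding S'_def by auto
    have finR: "finite R" using R(1) less.prems finite_subset unfolding S'_def by blast
    have "a \<notin> R" using R(1) unfolding S'_def by auto
    have "card S \<le> card (S' \<union> {a, f a, g a})"
      by (rule card_mono) (use less.prems in \<open>auto simp: S'_def\<close>)
    also have "\<dots> \<le> card S' + card {a, f a, g a}" by (rule card_Un_le)
    also have "card {a, f a, g a} \<le> 3" by (simp add: card_insert_if)
    finally have "card S \<le> 3 * card (insert a R)" using R(2) finR \<open>a \<notin> R\<close> by simp
    moreover have "\<forall>x\<in>insert a R. \<forall>y\<in>insert a R. x < y \<longrightarrow> y \<noteq> f x \<and> y \<noteq> g x"
      using R(1,3) a unfolding S'_def by (auto simp: subset_iff leD)
    ultimately show ?thesis using R(1) a(1) unfolding S'_def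
      by (intro exI[of _ "insert a R"]) auto
  qed auto
qed

text \<open>The path runs upwards, from \<open>x 1\<close> at the bottom; \<open>w i = 0\<close> encodes that \<open>x i\<close> has its back arc
  from \<open>U\<close>. Redirecting the vertices indexed by \<open>R\<close> to their path predecessors creates no cycle: two
  steps towards the root strictly decrease the index, because \<open>R\<close> has no two consecutive elements.\<close>

lemma redirected_path_leaves:
  fixes x :: "nat \<Rightarrow> 'a"
  assumes D: "digraph V A" and ot: "out_tree V A U T"
    and inj: "inj_on x {1..m}" and xV: "x ` {1..m} \<subseteq> V - U"
    and path: "\<And>i. 1 \<le> i \<Longrightarrow> i < m \<Longrightarrow> (x (Suc i), x i) \<in> A"
    and w: "\<And>i. i \<in> {1..m} \<Longrightarrow> w i \<noteq> 0 \<Longrightarrow> w i + 2 \<le> i \<and> (x (w i), x i) \<in> A"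
    and u: "\<And>i. i \<in> {1..m} \<Longrightarrow> w i = 0 \<Longrightarrow> u i \<in> U \<and> (u i, x i) \<in> A"
    and R: "R \<subseteq> {..<m}" "\<And>i. i \<in> R \<Longrightarrow> Suc i \<notin> R"
  shows "m \<le> max_leaves V A + card (Suc ` R \<union> w ` {i \<in> {1..m} - R. w i \<noteq> 0})"
proof -
  have finV: "finite V" using D unfolding digraph_def by blast
  obtain r where sub: "U \<subseteq> V" "T \<subseteq> A" and T: "arborescence r U T"
    using ot unfolding out_tree_iff_arborescence[OF finV] by blast
  define X where "X = x ` {1..m}"
  define q where "q i = (if i \<in> R then x (Suc i) else if w i = 0 then u i else x (w i))" for i
  define p where "p v = q (the_inv_into {1..m} x v)" for v
  have px: "p (x i) = q i" if "i \<in> {1..m}" for i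
    unfolding p_def using the_inv_into_f_f[OF inj that] by simp
  have q: "q i \<in> U \<union> X \<and> (q i, x i) \<in> A" if "i \<in> {1..m}" for i
  proof -
    consider "i \<in> R" | "i \<notin> R" "w i = 0" | "i \<notin> R" "w i \<noteq> 0" by blast
    then show ?thesis
    proof cases
      case 1
      then have "Suc i \<in> {1..m}" using R(1) by auto
      moreover have "(x (Suc i), x i) \<in> A" using path that 1 R(1) by auto
      ultimately show ?thesis using 1 unfolding q_def X_def by simp
    next
      case 2
      then show ?thesis using u[OF that] unfolding q_def by simp
    next
      case 3
      then have "w i \<in> {1..m}" using w[OF that] that by auto
      then show ?thesis using 3 w[OF that] unfolding q_def X_def by simp
    qed
  qed
  define P where "P = {(p v, v) |v. v \<in> X}"
  have arc: "(q i, x i) \<in> P" if "i \<in> {1..m}" for i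
    using px[OF that] that unfolding P_def X_def by force
  \<comment> \<open>This is split off because it is needed twice: for \<open>i\<close> itself, and
    for \<open>Suc i\<close> when \<open>i \<in> R\<close>. In the second case it appeals only to
    indices below \<open>i\<close>, so the induction on \<open>i\<close> goes through.\<close>
  have low: "\<exists>z\<in>U. (z, x i) \<in> P\<^sup>*"
    if "i \<in> {1..m}" "i \<notin> R" and IH: "\<And>j. j \<in> {1..m} \<Longrightarrow> j + 2 \<le> i \<Longrightarrow> \<exists>z\<in>U. (z, x j) \<in> P\<^sup>*" for i
  proof (cases "w i = 0")
    case True
    then show ?thesis using arc[OF that(1)] u[OF that(1)] that(2) unfolding q_def by auto
  next
    case False
    then have "w i \<in> {1..m}" "w i + 2 \<le> i" using w[OF that(1)] that by auto
    then obtain z where z: "z \<in> U" "(z, x (w i)) \<in> P\<^sup>*" using IH[of "w i"] by blast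
    moreover have "(x (w i), x i) \<in> P" using arc[OF that(1)] that(2) False unfolding q_def by simp
    ultimately show ?thesis by (meson rtrancl.rtrancl_into_rtrancl)
  qed
  have reach: "\<exists>z\<in>U. (z, x i) \<in> P\<^sup>*" if "i \<in> {1..m}" for i
    using that
  proof (induction i rule: less_induct)
    case (less i)
    show ?case
    proof (cases "i \<in> R")
      case True
      then have "Suc i \<in> {1..m}" "Suc i \<notin> R" using R by auto
      then obtain z where "z \<in> U" "(z, x (Suc i)) \<in> P\<^sup>*"
        using low[of "Suc i"] less.IH by auto
      moreover have "(x (Suc i), x i) \<in> P" using arc[OF less.prems] True unfolding q_def by simp
      ultimately show ?thesis by (meson rtrancl.rtrancl_into_rtrancl)
    next
      case False
      then show ?thesis using low[OF less.prems] less.IH by simp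
    qed
  qed
  have arb: "arborescence r (U \<union> X) (T \<union> P)"
    unfolding P_def
  proof (rule arborescence_extend[OF T])
    show "finite X" "X \<inter> U = {}" using xV unfolding X_def by auto
    show "p v \<in> U \<union> X" if v: "v \<in> X" for v
    proof -
      obtain i where "i \<in> {1..m}" "v = x i" using v unfolding X_def by blast
      then show ?thesis using q[of i] px[of i] by simp
    qed
    show "\<exists>u\<in>U. (u, v) \<in> {(p v, v) |v. v \<in> X}\<^sup>*" if v: "v \<in> X" for v
    proof -
      obtain i where "i \<in> {1..m}" "v = x i" using v unfolding X_def by blast
      then show ?thesis using reach[of i] unfolding P_def by simp
    qed
  qed
  have "P \<subseteq> A" using q px unfolding P_def X_def by auto
  then have ot': "out_tree V A (U \<union> X) (T \<union> P)"
    unfolding out_tree_iff_arborescence[OF finV] using arb sub xV unfolding X_def by blast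
  \<comment> \<open>\<open>N\<close> collects the indices of all path vertices that serve as
    parents; the remaining path vertices become leaves.\<close>
  define N where "N = Suc ` R \<union> w ` {i \<in> {1..m} - R. w i \<noteq> 0}"
  have N: "finite N" unfolding N_def using R(1) finite_subset by auto
  have "x ` ({1..m} - N) \<subseteq> leaves (U \<union> X) (T \<union> P)"
  proof
    fix v assume "v \<in> x ` ({1..m} - N)"
    then obtain i where i: "i \<in> {1..m}" "i \<notin> N" "v = x i" by blast
    have vX: "v \<in> X" "v \<notin> U" using i xV unfolding X_def by blast+
    have "(v, y) \<notin> P" for y
    proof
      assume "(v, y) \<in> P"
      then obtain j where j: "j \<in> {1..m}" "q j = x i" using px i(3) unfolding P_def X_def by auto
      consider "j \<in> R" | "j \<notin> R" "w j = 0" | "j \<notin> R" "w j \<noteq> 0" by blast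
      then show False
      proof cases
        case 1
        then have "x (Suc j) = x i" "Suc j \<in> {1..m}" using j R(1) unfolding q_def by auto
        then have "Suc j = i" using inj i(1) by (meson inj_onD)
        then show False using 1 i(2) unfolding N_def by blast
      next
        case 2
        then show False using u[OF j(1)] j(2) vX i(3) unfolding q_def by simp
      next
        case 3
        then have "x (w j) = x i" "w j \<in> {1..m}" using j w[OF j(1)] unfolding q_def by auto
        then have "w j = i" using inj i(1) by (meson inj_onD)
        then show False using 3 i(2) j(1) unfolding N_def by blast
      qed
    qed
    moreover have "(v, y) \<notin> T" for y using arborescenceD(3)[OF T] vX by blast
    ultimately show "v \<in> leaves (U \<union> X) (T \<union> P)"
      using leaves_iff[OF arborescenceD(7)[OF arb]] vX by blast
  qed
  moreover have "finite (leaves (U \<union> X) (T \<union> P))"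
    using arborescenceD(1)[OF arb] unfolding leaves_def by auto
  ultimately have "card (x ` ({1..m} - N)) \<le> card (leaves (U \<union> X) (T \<union> P))"
    by (intro card_mono)
  moreover have "card (x ` ({1..m} - N)) = card ({1..m} - N)"
    using inj by (intro card_image) (rule inj_on_subset, auto)
  moreover have "m - card N \<le> card ({1..m} - N)"
    using diff_card_le_card_Diff[OF N, of "{1..m}"] by simp
  ultimately show ?thesis
    using card_leaves_le_max_leaves[OF D ot'] unfolding N_def by linarith
qed

text \<open>Two choices of \<open>R\<close> are compared. The empty set gives
  \<open>m \<le> l + card W\<close>, where \<open>l = max_leaves V A\<close>. The sparse set
  \<open>R\<close> below gives \<open>m \<le> l + card E\<close> with
  \<open>card E + card R \<le> m\<close>, hence \<open>card R \<le> l\<close> and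
  \<open>card W \<le> 3 * l\<close>.\<close>

lemma hanging_path_length:
  fixes x :: "nat \<Rightarrow> 'a"
  assumes D: "digraph V A" and ot: "out_tree V A U T"
    and inj: "inj_on x {1..m}" and xV: "x ` {1..m} \<subseteq> V - U"
    and path: "\<And>i. 1 \<le> i \<Longrightarrow> i < m \<Longrightarrow> (x (Suc i), x i) \<in> A"
    and in_arc: "\<And>i. i \<in> {1..m} \<Longrightarrow>
      (\<exists>u\<in>U. (u, x i) \<in> A) \<or> (\<exists>j\<ge>1. j + 2 \<le> i \<and> (x j, x i) \<in> A)"
  shows "m \<le> 4 * max_leaves V A"
proof -
  have "\<forall>i\<in>{1..m}. \<exists>j. (j = 0 \<and> (\<exists>z\<in>U. (z, x i) \<in> A)) \<or>
      (j \<noteq> 0 \<and> j + 2 \<le> i \<and> (x j, x i) \<in> A)"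
  proof
    fix i assume "i \<in> {1..m}"
    from in_arc[OF this] show "\<exists>j. (j = 0 \<and> (\<exists>z\<in>U. (z, x i) \<in> A)) \<or>
      (j \<noteq> 0 \<and> j + 2 \<le> i \<and> (x j, x i) \<in> A)"
    proof
      assume "\<exists>j\<ge>1. j + 2 \<le> i \<and> (x j, x i) \<in> A"
      then obtain j where "1 \<le> j" "j + 2 \<le> i \<and> (x j, x i) \<in> A" by blast
      then show ?thesis by (intro exI[of _ j]) simp
    qed blast
  qed
  from bchoice[OF this] obtain w where w': "\<forall>i\<in>{1..m}. (w i = 0 \<and> (\<exists>z\<in>U. (z, x i) \<in> A)) \<or>
      (w i \<noteq> 0 \<and> w i + 2 \<le> i \<and> (x (w i), x i) \<in> A)"
    by blast
  define u where "u i = (SOME z. z \<in> U \<and> (z, x i) \<in> A)" for i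
  have u: "\<And>i. i \<in> {1..m} \<Longrightarrow> w i = 0 \<Longrightarrow> u i \<in> U \<and> (u i, x i) \<in> A"
    unfolding u_def by (rule someI_ex) (use w' in blast)
  have w: "w i + 2 \<le> i \<and> (x (w i), x i) \<in> A" if "i \<in> {1..m}" "w i \<noteq> 0" for i
    using bspec[OF w' that(1)] that(2) by simp
  have redirect: "m \<le> max_leaves V A + card (Suc ` R \<union> w ` {i \<in> {1..m} - R. w i \<noteq> 0})"
    if R: "R \<subseteq> {..<m}" "\<And>i. i \<in> R \<Longrightarrow> Suc i \<notin> R" for R
    by (rule redirected_path_leaves[where w = w and u = u, OF D ot inj xV]) (fact path w u R)+
  define dom_w where "dom_w = {i \<in> {1..m}. w i \<noteq> 0}"
  define W where "W = w ` dom_w"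
  have few: "m \<le> max_leaves V A + card W"
    using redirect[of "{}"] unfolding W_def dom_w_def by simp
  define c where "c y = (SOME i. i \<in> dom_w \<and> w i = y)" for y
  have c: "c y \<in> dom_w" "w (c y) = y" if "y \<in> W" for y
    using that someI_ex[of "\<lambda>i. i \<in> dom_w \<and> w i = y"] unfolding W_def c_def by auto
  have cW: "y + 2 \<le> c y" "c y \<le> m" "1 \<le> y" if "y \<in> W" for y
    using c[OF that] w[of "c y"] unfolding dom_w_def by auto
  have finW: "finite W" unfolding W_def dom_w_def by simp
  \<comment> \<open>Avoiding \<open>Suc a\<close> leaves no two consecutive elements in
    \<open>R\<close>. Avoiding \<open>Suc (c a)\<close> keeps \<open>c a\<close> out of
    \<open>R\<close>, so the back arc from \<open>a\<close> to \<open>c a\<close> survives and the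
    redirections create no further tails.\<close>
  obtain Y where Y: "Y \<subseteq> W" "card W \<le> 3 * card Y"
    "\<forall>a\<in>Y. \<forall>b\<in>Y. a < b \<longrightarrow> b \<noteq> Suc a \<and> b \<noteq> Suc (c a)"
    using greedy_independent_set[OF finW, of Suc "\<lambda>a. Suc (c a)"] by blast
  define R where "R = {i. Suc i \<in> Y}"
  have SucR: "Suc ` R = Y"
  proof -
    have "\<exists>i. y = Suc i" if "y \<in> Y" for y using cW(3)[of y] Y(1) that by (cases y) auto
    then show ?thesis unfolding R_def by (auto simp: image_iff)
  qed
  then have cardR: "card R = card Y" using card_image[of Suc R] by simp
  have R_less: "R \<subseteq> {..<m}"
  proof
    fix i assume "i \<in> R"
    then have "Suc i \<in> W" using Y(1) unfolding R_def by blast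
    then show "i \<in> {..<m}" using cW[of "Suc i"] by simp
  qed
  have R_sparse: "Suc i \<notin> R" if "i \<in> R" for i
    using Y(3) that unfolding R_def by blast
  note R = R_less R_sparse
  define E where "E = {i \<in> {1..m} - R. w i \<noteq> 0}"
  have "Y \<subseteq> w ` E"
  proof
    fix y assume y: "y \<in> Y"
    then have yW: "y \<in> W" using Y(1) by blast
    have "y < Suc (c y)" using cW(1)[OF yW] by simp
    then have "c y \<notin> R" using Y(3) y unfolding R_def by blast
    then have "c y \<in> E" using c(1)[OF yW] unfolding E_def dom_w_def by blast
    then show "y \<in> w ` E" using c(2)[OF yW] by force
  qed
  then have "card (Suc ` R \<union> w ` E) = card (w ` E)" using SucR by (simp add: sup_absorb2)
  also have "\<dots> \<le> card E" by (rule card_image_le) (simp add: E_def)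
  finally have "m \<le> max_leaves V A + card E"
    using redirect[OF R] unfolding E_def by simp
  moreover have "card E + card R \<le> m"
  proof (cases "m = 0")
    case True
    then show ?thesis using R(1) unfolding E_def by simp
  next
    case False
    \<comment> \<open>\<open>R\<close> may contain 0, which indexes no path vertex. Then 1 is not in
      \<open>R\<close> by sparsity, and neither 0 nor 1 is in \<open>E\<close>, since there
      \<open>w i \<ge> 1\<close> forces \<open>i \<ge> 3\<close>. So one of the \<open>m + 1\<close>
      indices \<open>0..m\<close> is always missed.\<close>
    obtain a where a: "a = 0 \<or> a = 1" "a \<notin> R" using R(2)[of 0] by (metis One_nat_def)
    have "E \<union> R \<subseteq> {0..m} - {a}"
    proof
      fix i assume i: "i \<in> E \<union> R"
      show "i \<in> {0..m} - {a}"
      proof (cases "i \<in> E")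
        case True
        then show ?thesis using w[of i] a(1) unfolding E_def by auto
      next
        case False
        then have "i \<in> R" using i by blast
        then have "i \<noteq> a" "i < m" using a(2) R_less by blast+
        then show ?thesis by simp
      qed
    qed
    then have "card (E \<union> R) \<le> card ({0..m} - {a})" by (intro card_mono) auto
    moreover have "card (E \<union> R) = card E + card R"
      by (rule card_Un_disjoint) (use R(1) finite_subset in \<open>auto simp: E_def\<close>)
    moreover have "card ({0..m} - {a}) = m" using a(1) False by auto
    ultimately show ?thesis by simp
  qed
  ultimately show ?thesis using few Y(2) cardR by linarith
qed

section \<open>Subtrees, pruning and change of a parent\<close>

lemma arborescence_subtree:
  assumes T: "arborescence r V T" and v: "v \<in> V"
  defines "U \<equiv> {y. (v, y) \<in> T\<^sup>*}"
  shows "arborescence v U (T \<inter> U \<times> U)" and "U \<subseteq> V"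
proof -
  show UV: "U \<subseteq> V"
  proof
    fix y assume "y \<in> U"
    then show "y \<in> V" unfolding U_def
      using v arborescenceD(3)[OF T] by (auto elim: rtranclE)
  qed
  have "(v, y) \<in> (T \<inter> U \<times> U)\<^sup>*" if "(v, y) \<in> T\<^sup>*" for y
    using that
  proof (induction rule: rtrancl_induct)
    case (step y z)
    then have "(y, z) \<in> T \<inter> U \<times> U" unfolding U_def by auto
    then show ?case using step.IH by (meson rtrancl.rtrancl_into_rtrancl)
  qed simp
  moreover have "(u, v) \<notin> T" if "u \<in> U" for u
    using that arborescence_acyclic[OF T, of v] unfolding U_def
    by (auto intro: rtrancl_into_trancl1)
  ultimately show "arborescence v U (T \<inter> U \<times> U)"
    unfolding arborescence_def
    using arborescenceD(1,5)[OF T] UV finite_subset U_def by auto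
qed

lemma arborescence_prune:
  assumes T: "arborescence r V T" and "r \<notin> S"
    and closed: "\<And>u v. u \<in> S \<Longrightarrow> (u, v) \<in> T \<Longrightarrow> v \<in> S"
  shows "arborescence r (V - S) (T \<inter> (V - S) \<times> (V - S))"
proof -
  let ?T = "T \<inter> (V - S) \<times> (V - S)"
  have "(r, v) \<in> ?T\<^sup>*" if "(r, v) \<in> T\<^sup>*" "v \<notin> S" for v
    using that
  proof (induction rule: rtrancl_induct)
    case (step y z)
    then have "y \<notin> S" using closed by blast
    moreover have "(y, z) \<in> ?T" using step calculation arborescenceD(3)[OF T] by auto
    ultimately show ?case using step.IH by (meson rtrancl.rtrancl_into_rtrancl)
  qed simp
  then show ?thesis
    unfolding arborescence_def using arborescenceD[OF T] \<open>r \<notin> S\<close> by auto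
qed

text \<open>The root path of a vertex that is not a descendant of \<open>v\<close> avoids
  \<open>v\<close> and survives. This applies to \<open>u\<close>; then \<open>v\<close> is reached
  through \<open>u\<close>, and the descendants of \<open>v\<close> through
  \<open>v\<close>.\<close>

lemma arborescence_swap:
  assumes T: "arborescence r V T" and pv: "(p, v) \<in> T"
    and u: "u \<in> V" "(v, u) \<notin> T\<^sup>*"
  shows "arborescence r V (insert (u, v) (T - {(p, v)}))"
proof -
  let ?T = "insert (u, v) (T - {(p, v)})"
  have pv': "y = p" if "(y, v) \<in> T" for y using arborescenceD(5)[OF T that pv] .
  have up: "(r, y) \<in> ?T\<^sup>*" if "(r, y) \<in> T\<^sup>*" "(v, y) \<notin> T\<^sup>*" for y
    using that
  proof (induction rule: rtrancl_induct)
    case (step y z)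
    then have "(v, y) \<notin> T\<^sup>*" "z \<noteq> v" by (auto intro: rtrancl_into_rtrancl)
    then have "(r, y) \<in> ?T\<^sup>*" "(y, z) \<in> ?T" using step by auto
    then show ?case by (rule rtrancl.rtrancl_into_rtrancl)
  qed simp
  have "(r, u) \<in> ?T\<^sup>*" using up u arborescenceD(6)[OF T] by blast
  then have rv: "(r, v) \<in> ?T\<^sup>*" by (rule rtrancl.rtrancl_into_rtrancl) simp
  have down: "(r, y) \<in> ?T\<^sup>*" if "(v, y) \<in> T\<^sup>*" for y
    using that
  proof (induction rule: rtrancl_induct)
    case base
    then show ?case by (rule rv)
  next
    case (step y z)
    have "z \<noteq> v"
      using step.hyps arborescence_acyclic[OF T, of v] by (auto intro: rtrancl_into_trancl1)
    then have "(y, z) \<in> ?T" using step.hyps by auto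
    then show ?case using step.IH by (meson rtrancl.rtrancl_into_rtrancl)
  qed
  have reach: "(r, y) \<in> ?T\<^sup>*" if "y \<in> V" for y
    using up[of y] down[of y] arborescenceD(6)[OF T that] by blast
  have "v \<in> V" "v \<noteq> r" using pv arborescenceD(3,4)[OF T] by auto
  then show ?thesis
    unfolding arborescence_def
    using arborescenceD(1-5)[OF T] u(1) pv' reach by auto
qed

section \<open>Length of unary chains in a leaf-maximal out-branching\<close>

lemma out_degree_1_unique:
  assumes "out_degree T v = 1" "(v, w) \<in> T" "(v, w') \<in> T"
  shows "w = w'"
  using assms unfolding out_degree_def by (metis card_1_singletonE mem_Collect_eq singletonD)

text \<open>Replacing the parent \<open>p\<close> of \<open>v\<close> by \<open>u\<close> makes
  \<open>p\<close> a leaf, because \<open>v\<close> was its only child, and can destroy no leaf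
  other than \<open>u\<close>.\<close>

lemma max_leaf_in_neighbour:
  assumes D: "digraph V A" and B: "B \<subseteq> A" "arborescence r V B"
    and max: "\<And>B'. out_branching V A B' \<Longrightarrow> card (leaves V B') \<le> card (leaves V B)"
    and pv: "(p, v) \<in> B" "out_degree B p = 1"
    and u: "(u, v) \<in> A" "u \<noteq> p" "(v, u) \<notin> B\<^sup>*"
  shows "u \<in> leaves V B"
proof (rule ccontr)
  assume nl: "u \<notin> leaves V B"
  have fin: "finite V" and AV: "A \<subseteq> V \<times> V" using D unfolding digraph_def by auto
  define B' where "B' = insert (u, v) (B - {(p, v)})"
  have B': "arborescence r V B'"
    unfolding B'_def using arborescence_swap[OF B(2) pv(1)] u AV by blast
  have "B' \<subseteq> A" unfolding B'_def using B(1) u(1) by blast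
  then have ob: "out_branching V A B'"
    unfolding out_branching_def out_tree_iff_arborescence[OF fin] using B' by blast
  note leaf = leaves_iff[OF arborescenceD(7)[OF B(2)]]
    leaves_iff[OF arborescenceD(7)[OF B'], unfolded B'_def]
  have "p \<in> V" using pv(1) arborescenceD(3)[OF B(2)] by blast
  then have "insert p (leaves V B) \<subseteq> leaves V B'"
    using nl u AV out_degree_1_unique[OF pv(2,1)] unfolding B'_def by (auto simp: leaf)
  moreover have "p \<notin> leaves V B" using pv(1) leaf by blast
  moreover have "finite (leaves V B')" "finite (leaves V B)" using fin unfolding leaves_def by auto
  ultimately have "card (leaves V B) < card (leaves V B')"
    by (intro psubset_card_mono) auto
  then show False using max[OF ob] by simp
qed

text \<open>The chain is numbered upwards from \<open>s 0\<close>. Only the vertices with index from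
  1 to \<open>N - 1\<close> are inner; removing the lowest bad one, \<open>s b\<close>, leaves two
  paths of at most \<open>4 * max_leaves V A\<close> vertices each.\<close>

lemma unary_chain_length:
  fixes s :: "nat \<Rightarrow> 'a"
  assumes D: "digraph V A"
    and deg: "(\<forall>v\<in>V. in_degree A v \<ge> 3) \<or> (oriented A \<and> (\<forall>v\<in>V. in_degree A v \<ge> 2))"
    and B: "B \<subseteq> A" "arborescence r V B"
    and max: "\<And>B'. out_branching V A B' \<Longrightarrow> card (leaves V B') \<le> card (leaves V B)"
    and s: "\<And>i. i < N \<Longrightarrow> (s (Suc i), s i) \<in> B \<and> out_degree B (s (Suc i)) = 1"
  shows "N \<le> 8 * max_leaves V A + 2"
proof (cases "N = 0")
  case False
  have fin: "finite V" and AV: "A \<subseteq> V \<times> V"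
    using D unfolding digraph_def by auto
  then have finA: "finite A" by (meson finite_SigmaI finite_subset)
  have only_child: "y = s i" if "i < N" "(s (Suc i), y) \<in> B" for i y
    using out_degree_1_unique s[OF that(1)] that(2) by metis
  have sV: "s i \<in> V" if "i \<le> N" for i
    using s[of i] s[of "i - 1"] that False B(1) AV by (cases "i < N") auto
  have desc: "(s j, s i) \<in> B\<^sup>+" if "i < j" "j \<le> N" for i j
    using that
  proof (induction j)
    case (Suc j)
    then have e: "(s (Suc j), s j) \<in> B" using s by auto
    show ?case
    proof (cases "i = j")
      case False
      then show ?thesis using Suc e by (meson less_SucE Suc_leD trancl_into_trancl2)
    qed (use e in auto)
  qed simp
  have not_desc: "(s i, s j) \<notin> B\<^sup>*" if "i < j" "j \<le> N" for i j
    using desc[OF that] arborescence_acyclic[OF B(2)] by (meson rtrancl_trancl_trancl)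
  have inj: "s i \<noteq> s j" if "i < j" "j \<le> N" for i j
    using desc[OF that] arborescence_acyclic[OF B(2)] by metis
  define U where "U = {y. (s 0, y) \<in> B\<^sup>*}"
  have below: "u \<in> U \<or> (\<exists>j\<le>i. u = s j)" if "(s i, u) \<in> B\<^sup>*" "i \<le> N" for i u
    using that
  proof (induction i)
    case 0
    then show ?case unfolding U_def by simp
  next
    case (Suc i)
    show ?case
    proof (cases "u = s (Suc i)")
      case False
      then obtain y where "(s (Suc i), y) \<in> B" "(y, u) \<in> B\<^sup>*"
        using Suc.prems(1) by (metis converse_rtranclE)
      then have "(s i, u) \<in> B\<^sup>*" using only_child Suc.prems(2) by auto
      then show ?thesis using Suc.IH Suc.prems(2) by (meson Suc_leD le_SucI)
    qed auto
  qed
  have sU: "s i \<notin> U" if "1 \<le> i" "i \<le> N" for i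
    using not_desc[of 0 i] that unfolding U_def by auto
  have "\<exists>u. (u, s i) \<in> A \<and> u \<noteq> s (Suc i) \<and> u \<noteq> s (i - 1)" if i: "1 \<le> i" "i < N" for i
  proof -
    have finI: "finite {u. (u, s i) \<in> A}"
      by (rule finite_subset[of _ "fst ` A"]) (use finA in force)+
    have more: "\<exists>u. (u, s i) \<in> A \<and> u \<notin> F" if "card F < in_degree A (s i)" "finite F" for F
      using that finI unfolding in_degree_def
      by (metis card_mono leD mem_Collect_eq subsetI)
    show ?thesis
    proof (cases "\<forall>v\<in>V. in_degree A v \<ge> 3")
      case True
      then have "3 \<le> in_degree A (s i)" using sV i by simp
      moreover have "card {s (Suc i), s (i - 1)} \<le> 2" by (simp add: card_insert_if)
      ultimately show ?thesis using more[of "{s (Suc i), s (i - 1)}"] by auto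
    next
      case False
      then have or: "oriented A" and "2 \<le> in_degree A (s i)" using deg sV i by auto
      then obtain u where u: "(u, s i) \<in> A" "u \<noteq> s (Suc i)" using more[of "{s (Suc i)}"] by auto
      have "(s i, s (i - 1)) \<in> A" using s[of "i - 1"] i B(1) by auto
      \<comment> \<open>In an oriented graph the child is never an in-neighbour, so two
        in-neighbours suffice.\<close>
      then have "u \<noteq> s (i - 1)" using or u(1) unfolding oriented_def by blast
      then show ?thesis using u by blast
    qed
  qed
  then obtain u where u: "\<And>i. 1 \<le> i \<Longrightarrow> i < N \<Longrightarrow>
      (u i, s i) \<in> A \<and> u i \<noteq> s (Suc i) \<and> u i \<noteq> s (i - 1)"
    by metis
  have uV: "u i \<in> V" if "1 \<le> i" "i < N" for i using u[OF that] AV by blast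
  define good where "good i \<longleftrightarrow> (s i, u i) \<in> B\<^sup>*" for i
  have bad: "u i \<in> leaves V B" if "1 \<le> i" "i < N" "\<not> good i" for i
    using max_leaf_in_neighbour[OF D B max, of "s (Suc i)" "s i" "u i"] s[of i] u[of i] that
    unfolding good_def by blast
  have back_arc: "u i \<in> U \<or> (\<exists>j. j + 2 \<le> i \<and> u i = s j)" if i: "1 \<le> i" "i < N" "good i" for i
  proof -
    have "j + 2 \<le> i" if "j \<le> i" "u i = s j" for j
    proof -
      have "u i \<noteq> s i" using u[OF i(1,2)] D unfolding digraph_def by auto
      then have "j \<noteq> i" "j \<noteq> i - 1" using u[OF i(1,2)] that by auto
      then show ?thesis using that(1) by linarith
    qed
    then show ?thesis using below[of i "u i"] i unfolding good_def by auto
  qed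
  \<comment> \<open>If every inner vertex is good, \<open>b = N\<close> and the upper part is
    empty.\<close>
  define b where "b = (if \<exists>i. 1 \<le> i \<and> i < N \<and> \<not> good i
    then LEAST i. 1 \<le> i \<and> i < N \<and> \<not> good i else N)"
  have b: "1 \<le> b" "b \<le> N" "b < N \<Longrightarrow> \<not> good b"
    "\<And>i. 1 \<le> i \<Longrightarrow> i < b \<Longrightarrow> good i"
  proof -
    have "1 \<le> b \<and> b \<le> N \<and> (b < N \<longrightarrow> \<not> good b)"
    proof (cases "\<exists>i. 1 \<le> i \<and> i < N \<and> \<not> good i")
      case True
      then show ?thesis using LeastI_ex[OF True] unfolding b_def by simp
    next
      case False
      then show ?thesis using \<open>N \<noteq> 0\<close> unfolding b_def by auto
    qed
    then show "1 \<le> b" "b \<le> N" "b < N \<Longrightarrow> \<not> good b" by auto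
    show "good i" if "1 \<le> i" "i < b" for i
      using that not_less_Least[of i "\<lambda>i. 1 \<le> i \<and> i < N \<and> \<not> good i"] \<open>b \<le> N\<close>
      unfolding b_def by (auto split: if_splits)
  qed
  \<comment> \<open>The base is the subtree at \<open>s 0\<close>. All path vertices are good here,
    and a back arc from \<open>s 0\<close> counts as an arc from the base.\<close>
  have lower: "b - 1 \<le> 4 * max_leaves V A"
  proof (rule hanging_path_length[OF D, where x = s])
    show "out_tree V A U (B \<inter> U \<times> U)"
      unfolding out_tree_iff_arborescence[OF fin] U_def
      using arborescence_subtree[OF B(2) sV[of 0]] B(1) by blast
    show "inj_on s {1..b - 1}"
    proof (rule linorder_inj_onI)
      show "s i \<noteq> s j" if "i < j" "i \<in> {1..b - 1}" "j \<in> {1..b - 1}" for i j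
        using inj[of i j] that b(2) by auto
    qed auto
    show "s ` {1..b - 1} \<subseteq> V - U" using sV sU b(2) by auto
    show "(s (Suc i), s i) \<in> A" if "1 \<le> i" "i < b - 1" for i
      using s[of i] that b(2) B(1) by auto
    show "(\<exists>y\<in>U. (y, s i) \<in> A) \<or> (\<exists>j\<ge>1. j + 2 \<le> i \<and> (s j, s i) \<in> A)"
      if "i \<in> {1..b - 1}" for i
    proof -
      have i: "1 \<le> i" "i < N" "good i" using that b by auto
      have "s 0 \<in> U" unfolding U_def by simp
      then have "s j \<in> U \<or> 1 \<le> j" for j by (cases j) auto
      then show ?thesis using back_arc[OF i] u[OF i(1,2)] by metis
    qed
  qed
  have upper: "N - 1 - b \<le> 4 * max_leaves V A"
  proof (cases "b < N - 1")
    case bN: True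
    define m where "m = N - 1 - b"
    define x where "x = (\<lambda>i. s (b + i))"
    define X where "X = x ` {1..m}"
    \<comment> \<open>Reattaching \<open>s b\<close> to \<open>u b\<close>, a leaf of
      \<open>B\<close> and hence outside \<open>X\<close>, cuts the only arc of \<open>B\<close>
      leaving \<open>X\<close> downwards. Therefore \<open>X\<close> can be pruned while everything
      below \<open>s b\<close> stays in the base.\<close>
    define B' where "B' = insert (u b, s b) (B - {(s (Suc b), s b)})"
    have "\<not> good b" using b(3) bN by simp
    then have B': "arborescence r V B'"
      unfolding B'_def using bN s[of b] uV[of b] b(1) unfolding good_def
      by (intro arborescence_swap[OF B(2)]) auto
    have no_leaf: "s (Suc i) \<notin> leaves V B" if "i < N" for i
      using s[OF that] leaves_iff[OF arborescenceD(7)[OF B(2)]] by blast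
    have leafX: "y \<notin> X" if "y \<in> leaves V B" for y
    proof
      assume "y \<in> X"
      then obtain i where i: "1 \<le> i" "i \<le> m" "y = s (b + i)" unfolding X_def x_def by auto
      then have "b + i - 1 < N" "Suc (b + i - 1) = b + i" using bN unfolding m_def by auto
      then show False using no_leaf[of "b + i - 1"] that i(3) by simp
    qed
    have ubX: "u b \<notin> X" using leafX bad[of b] b bN by auto
    have "r \<notin> X"
    proof
      assume "r \<in> X"
      then obtain i where i: "i \<le> m" "r = s (b + i)" unfolding X_def x_def by auto
      then have "b + i < N" using bN unfolding m_def by auto
      then show False using s i(2) arborescenceD(4)[OF B(2)] by metis
    qed
    moreover have "v \<in> X" if y: "y \<in> X" and yv': "(y, v) \<in> B'" for y v
    proof -
      obtain i where i: "1 \<le> i" "i \<le> m" "y = s (b + i)" using y unfolding X_def x_def by auto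
      have "(y, v) \<noteq> (u b, s b)" using y ubX by auto
      then have yv: "(y, v) \<in> B" "(y, v) \<noteq> (s (Suc b), s b)" using yv' unfolding B'_def by auto
      obtain i' where i': "i = Suc i'" using i(1) by (cases i) auto
      then have v: "v = s (b + i')" using only_child[of "b + i'" v] yv(1) i m_def by auto
      then have "i' \<noteq> 0" using yv(2) i(3) i' by (cases i') auto
      then show ?thesis using v i(2) i' unfolding X_def x_def by auto
    qed
    ultimately have arb: "arborescence r (V - X) (B' \<inter> (V - X) \<times> (V - X))"
      by (rule arborescence_prune[OF B'])
    have "m \<le> 4 * max_leaves V A"
    proof (rule hanging_path_length[OF D, where x = x])
      have "B' \<subseteq> A" unfolding B'_def using B(1) u[of b] b bN by auto
      then show "out_tree V A (V - X) (B' \<inter> (V - X) \<times> (V - X))"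
        unfolding out_tree_iff_arborescence[OF fin] using arb by blast
      show "inj_on x {1..m}"
      proof (rule linorder_inj_onI)
        show "x i \<noteq> x j" if "i < j" "i \<in> {1..m}" "j \<in> {1..m}" for i j
          using inj[of "b + i" "b + j"] that bN unfolding x_def m_def by auto
      qed auto
      show "x ` {1..m} \<subseteq> V - (V - X)" using sV unfolding X_def x_def m_def by auto
      show "(x (Suc i), x i) \<in> A" if "1 \<le> i" "i < m" for i
        using s[of "b + i"] that B(1) unfolding x_def m_def by auto
      show "(\<exists>y\<in>V - X. (y, x i) \<in> A) \<or> (\<exists>j\<ge>1. j + 2 \<le> i \<and> (x j, x i) \<in> A)"
        if "i \<in> {1..m}" for i
      proof -
        have i: "1 \<le> b + i" "b + i < N" using that unfolding m_def by auto
        have uA: "(u (b + i), x i) \<in> A" using u[OF i] unfolding x_def by blast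
        show ?thesis
        proof (cases "u (b + i) \<in> X")
          case True
          then obtain j where j: "1 \<le> j" "j \<le> m" "u (b + i) = s (b + j)"
            unfolding X_def x_def by auto
          \<comment> \<open>Bad path vertices have their chosen in-neighbour among the leaves of
            \<open>B\<close>, hence in the base; an in-neighbour in \<open>X\<close> therefore
            forces a back arc.\<close>
          have "good (b + i)" using True bad[OF i] leafX by blast
          moreover have "u (b + i) \<notin> U" using j sU[of "b + j"] unfolding m_def by auto
          ultimately obtain l where l: "l + 2 \<le> b + i" "s (b + j) = s l"
            using back_arc[OF i] unfolding j(3) by blast
          have "l \<le> N" "b + j \<le> N" using l(1) i(2) j(2) bN unfolding m_def by linarith+
          then have "l = b + j" using inj[of l "b + j"] inj[of "b + j" l] l(2)
            by (metis linorder_neqE_nat)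
          then have "j + 2 \<le> i" using l(1) by linarith
          moreover have "(x j, x i) \<in> A" using uA j(3) unfolding x_def by simp
          ultimately show ?thesis using j(1) by blast
        next
          case False
          then show ?thesis using uA uV[OF i] by blast
        qed
      qed
    qed
    then show ?thesis unfolding m_def .
  qed simp
  show ?thesis using lower upper by linarith
qed simp

section \<open>Counting vertices by unary chains\<close>

text \<open>Out-degrees sum to \<open>card V - 1\<close>. Summing
  \<open>1 + [d \<noteq> 1] \<le> d + 2 * [d = 0]\<close> over all out-degrees \<open>d\<close>
  gives the bound.\<close>

lemma card_out_degree_not_1:
  assumes T: "arborescence r V T"
  shows "card {v \<in> V. out_degree T v \<noteq> 1} + 1 \<le> 2 * card (leaves V T)"
proof -
  have fin: "finite V" "finite T" and TV: "T \<subseteq> V \<times> V" using arborescenceD[OF T] by auto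
  have fin_out: "\<forall>v\<in>V. finite {w. (v, w) \<in> T}"
    using TV fin(1) by (auto intro: finite_subset[of _ V])
  have "T = Sigma V (\<lambda>v. {w. (v, w) \<in> T})" using TV by auto
  then have "card T = (\<Sum>v\<in>V. out_degree T v)"
    unfolding out_degree_def
    using card_SigmaI[OF fin(1), of "\<lambda>v. {w. (v, w) \<in> T}"] fin_out by simp
  then have sum: "(\<Sum>v\<in>V. out_degree T v) + 1 = card V"
    using arborescence_card[OF T] arborescenceD(1,2)[OF T]
    by (metis Suc_eq_plus1 Suc_pred' card_gt_0_iff empty_iff)
  let ?E = "{v \<in> V. out_degree T v \<noteq> 1}"
  have "card V + card ?E = (\<Sum>v\<in>V. 1 + (if out_degree T v \<noteq> 1 then 1 else 0))"
    using fin(1) unfolding sum.distrib by (simp add: sum.If_cases Int_def)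
  also have "\<dots> \<le> (\<Sum>v\<in>V. out_degree T v + 2 * (if out_degree T v = 0 then 1 else 0))"
    by (rule sum_mono) auto
  also have "\<dots> = (\<Sum>v\<in>V. out_degree T v) + 2 * card (leaves V T)"
    unfolding leaves_def using fin(1)
    by (simp add: sum.distrib sum.If_cases Int_def flip: sum_distrib_left)
  finally show ?thesis using sum by linarith
qed

text \<open>Following unique children downwards from any vertex ends at a vertex \<open>e\<close> of
  out-degree different from 1. The vertices ending at the same \<open>e\<close> form a single chain,
  since parents are unique.\<close>

lemma card_le_of_unary_chains:
  assumes T: "arborescence r V T"
    and chain: "\<And>s N. (\<And>i. i < N \<Longrightarrow> (s (Suc i), s i) \<in> T \<and> out_degree T (s (Suc i)) = 1) \<Longrightarrow> N < c"
  shows "card V \<le> card {v \<in> V. out_degree T v \<noteq> 1} * c"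
proof -
  define E where "E = {v \<in> V. out_degree T v \<noteq> 1}"
  define C where "C = {(u, v) \<in> T. out_degree T u = 1}"
  define S where "S e = {v. (v, e) \<in> C\<^sup>*}" for e
  have finE: "finite E" using arborescenceD(1)[OF T] unfolding E_def by simp
  have "acyclic T" using arborescence_acyclic[OF T] unfolding acyclic_def by blast
  then have "wf (T\<inverse>)" using arborescenceD(7)[OF T] by (rule finite_acyclic_wf_converse[rotated])
  then have "v \<in> V \<longrightarrow> (\<exists>e\<in>E. v \<in> S e)" for v
  proof (induction v rule: wf_induct_rule)
    case (less v)
    show ?case
    proof (cases "out_degree T v = 1")
      case True
      then obtain w where "(v, w) \<in> T"
        unfolding out_degree_def by (metis card_1_singletonE insertI1 mem_Collect_eq)
      then have "(v, w) \<in> C" "w \<in> V" "(w, v) \<in> T\<inverse>"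
        using True arborescenceD(3)[OF T] unfolding C_def by auto
      then obtain e where "e \<in> E" "(w, e) \<in> C\<^sup>*" using less.IH unfolding S_def by blast
      then show ?thesis
        using \<open>(v, w) \<in> C\<close> unfolding S_def by (auto intro: converse_rtrancl_into_rtrancl)
    qed (auto simp: E_def S_def)
  qed
  then have cover: "V \<subseteq> (\<Union>e\<in>E. S e)" by blast
  have S: "finite (S e) \<and> card (S e) \<le> c" for e
  proof -
    \<comment> \<open>\<open>s\<close> iterates the parent map of \<open>C\<close> upwards from
      \<open>e\<close>. Its values are arbitrary once no parent in \<open>C\<close> exists, so
      \<open>chain_to i\<close> records that the first \<open>i\<close> steps are genuine
      arcs.\<close>
    define s where "s i = ((\<lambda>v. SOME u. (u, v) \<in> C) ^^ i) e" for i
    define chain_to where "chain_to i \<longleftrightarrow> (\<forall>j<i. (s (Suc j), s j) \<in> C)" for i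
    have parent: "(SOME u. (u, v) \<in> C) = u" if "(u, v) \<in> C" for u v
      using someI[of "\<lambda>u. (u, v) \<in> C", OF that] that arborescenceD(5)[OF T]
      unfolding C_def by blast
    have ex: "\<exists>i. v = s i \<and> chain_to i" if "(v, e) \<in> C\<^sup>*" for v
      using that
    proof (induction rule: converse_rtrancl_induct)
      case base
      then show ?case by (rule exI[of _ 0]) (simp add: s_def chain_to_def)
    next
      case (step y z)
      then obtain i where i: "z = s i" "chain_to i" by blast
      then have "y = s (Suc i)" using parent[OF step.hyps(1)] by (simp add: s_def)
      moreover from this have "chain_to (Suc i)"
        using i step.hyps(1) unfolding chain_to_def by (auto simp: less_Suc_eq)
      ultimately show ?case by blast
    qed
    have "i < c" if "chain_to i" for i
      by (rule chain[of _ s]) (use that in \<open>auto simp: chain_to_def C_def\<close>)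
    then have "S e \<subseteq> s ` {..<c}" using ex unfolding S_def by blast
    then show ?thesis
      using surj_card_le[OF finite_lessThan, of "S e" s c] finite_subset[of "S e" "s ` {..<c}"]
      by simp
  qed
  have "card V \<le> card (\<Union>e\<in>E. S e)" using cover finE S by (intro card_mono) auto
  also have "\<dots> \<le> (\<Sum>e\<in>E. card (S e))" by (rule card_UN_le[OF finE])
  also have "\<dots> \<le> card E * c" using sum_bounded_above[of E "\<lambda>e. card (S e)" c] S by simp
  finally show ?thesis unfolding E_def .
qed

theorem theorem4:
  fixes V :: "'a set" and A :: "('a \<times> 'a) set"
  assumes "digraph V A"
    and "\<exists>B. out_branching V A B"
    and "(\<forall>v\<in>V. in_degree A v \<ge> 3) \<or> (oriented A \<and> (\<forall>v\<in>V. in_degree A v \<ge> 2))"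
  shows "real (max_leaves V A) \<ge> sqrt (real (card V)) / 4"
proof -
  define k where "k = max_leaves V A"
  have fin: "finite V" using assms(1) unfolding digraph_def by blast
  have "\<forall>B. out_branching V A B \<longrightarrow> card (leaves V B) < Suc (card V)"
    using fin unfolding leaves_def by (auto simp: less_Suc_eq_le intro: card_mono)
  moreover obtain B0 where "out_branching V A B0" using assms(2) by blast
  ultimately obtain B where B: "out_branching V A B"
    "\<And>B'. out_branching V A B' \<Longrightarrow> card (leaves V B') \<le> card (leaves V B)"
    using ex_has_greatest_nat[of "out_branching V A" B0 "\<lambda>B. card (leaves V B)"] by metis
  then have ot: "out_tree V A V B" unfolding out_branching_def by blast
  then obtain r where T: "B \<subseteq> A" "arborescence r V B"
    unfolding out_tree_iff_arborescence[OF fin] by blast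
  have "card (leaves V B) \<le> k"
    using card_leaves_le_max_leaves[OF assms(1) ot] unfolding k_def .
  then have E: "card {v \<in> V. out_degree B v \<noteq> 1} + 1 \<le> 2 * k"
    using card_out_degree_not_1[OF T(2)] by linarith
  have "card V \<le> card {v \<in> V. out_degree B v \<noteq> 1} * (8 * k + 3)"
  proof (rule card_le_of_unary_chains[OF T(2)])
    fix s N
    assume "\<And>i. i < N \<Longrightarrow> (s (Suc i), s i) \<in> B \<and> out_degree B (s (Suc i)) = 1"
    then have "N \<le> 8 * k + 2"
      unfolding k_def using unary_chain_length[OF assms(1,3) T B(2)] by blast
    then show "N < 8 * k + 3" by simp
  qed
  also have "\<dots> \<le> (2 * k - 1) * (8 * k + 3)" using E by (intro mult_right_mono) auto
  also have "\<dots> \<le> (4 * k)\<^sup>2"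
  proof -
    \<comment> \<open>With \<open>k \<ge> 1\<close> the subtraction is not truncated and the product
      is \<open>16 * k * k - 2 * k - 3\<close>.\<close>
    obtain j where "k = Suc j" using E by (cases k) auto
    then show ?thesis by (simp add: power2_eq_square algebra_simps)
  qed
  finally have "real (card V) \<le> (4 * real k)\<^sup>2"
    by (metis of_nat_le_iff of_nat_mult of_nat_numeral of_nat_power)
  then have "sqrt (real (card V)) \<le> 4 * real k" by (intro real_le_lsqrt) auto
  then show ?thesis unfolding k_def by simp
qed

end
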